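(* Let $p\notin\{2,11\}$ be a prime such that all roots of $X^3-X^2-X-1$ lie in $\mathbb Q_p$ and $3\nmid N_p$. Assume that every $\ell\in\{0,1,\dots,N_p-1\}$ with $p\mid T(\ell)$ satisfies both $T(\ell+N_p)\not\equiv T(\ell)\pmod{p^2}$ and $\ell\equiv a\pmod{N_p}$ for some $a\in\{0,-1,-4,-17,1/3,-5/3\}$. Then $\mathrm{MLR}(p)$ holds.
   Context: $T$ is the Tribonacci sequence ($T(0)=0,T(1)=T(2)=1$, $T(n+3)=T(n+2)+T(n+1)+T(n)$, $n\in\mathbb Z$); $\nu_p$ is the $p$-adic valuation on $\mathbb Q$, $\nu_p(0)=\infty$. $N_p$ is the order of the subgroup of $(\mathcal O/p\mathcal O)^\times$ generated by the images of the roots of $X^3-X^2-X-1$, where $\mathcal O$ is the ring of integers of the splitting field of this polynomial over $\mathbb Q_p$ (here $\mathcal O=\mathbb Z_p$). Congruences of rationals modulo $M$: $x\equiv y\pmod M$ means $mx\equiv my\pmod M$ for some $m\in\mathbb Z$ coprime to $M$ with $mx,my\in\mathbb Z$. $\mathrm{MLR}(p)$: there exists a positive integer $Q$ such that for every $i\in\{0,\dots,Q-1\}$ either (C) there is $\kappa_i\in\mathbb Z_{\ge0}$ with $\nu_p(T(n))=\kappa_i$ for all but finitely many $n\in\mathbb Z$, $n\equiv i\pmod Q$, or (L) there exist $a_i\in\mathbb Q$, $\kappa_i\in\mathbb Z$, $\mu_i\in\mathbb Z_{>0}$ with $\nu_p(a_i-i)\ge\nu_p(Q)$ and $\nu_p(T(n))=\kappa_i+\mu_i\nu_p(n-a_i)$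 for all but finitely many $n\in\mathbb Z$, $n\equiv i\pmod Q$. *)

theory Defs
  imports "HOL-Number_Theory.Number_Theory" "HOL-Algebra.Generated_Groups"
          "HOL-Library.Extended_Real"
begin

fun trib_pos :: "nat \<Rightarrow> int" where
  "trib_pos 0 = 0"
| "trib_pos (Suc 0) = 1"
| "trib_pos (Suc (Suc 0)) = 1"
| "trib_pos (Suc (Suc (Suc n))) = trib_pos (Suc (Suc n)) + trib_pos (Suc n) + trib_pos n"

text \<open>trib_neg k = T(-k), from T(m) = T(m+3) - T(m+2) - T(m+1).\<close>
fun trib_neg :: "nat \<Rightarrow> int" where
  "trib_neg 0 = 0"
| "trib_neg (Suc 0) = 0"
| "trib_neg (Suc (Suc 0)) = 1"
| "trib_neg (Suc (Suc (Suc k))) = trib_neg k - trib_neg (Suc k) - trib_neg (Suc (Suc k))"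

definition T :: "int \<Rightarrow> int" where
  "T n = (if n \<ge> 0 then trib_pos (nat n) else trib_neg (nat (- n)))"

definition vp :: "nat \<Rightarrow> rat \<Rightarrow> ereal" where
  "vp p x = (if x = 0 then \<infinity>
     else ereal (of_int (int (multiplicity (int p) (fst (quotient_of x)))
                       - int (multiplicity (int p) (snd (quotient_of x))))))"

definition rat_cong :: "rat \<Rightarrow> rat \<Rightarrow> int \<Rightarrow> bool" where
  "rat_cong x y M \<longleftrightarrow> (\<exists>m u v :: int. coprime m M \<and> of_int u = of_int m * x \<and>
      of_int v = of_int m * y \<and> [u = v] (mod M))"

text \<open>A p-adic integer is represented by a coherent sequence x with x k the approximation
  modulo p^k.  Zp_cubic_split p a b c says that X^3-X^2-X-1 = (X-\<alpha>)(X-\<beta>)(X-\<gamma>) in Z_p,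
  where \<alpha>,\<beta>,\<gamma> are the p-adic integers represented by a, b, c.  (Roots of a monic integral
  polynomial lying in Q_p lie in Z_p.)\<close>
definition padic_seq :: "nat \<Rightarrow> (nat \<Rightarrow> int) \<Rightarrow> bool" where
  "padic_seq p x \<longleftrightarrow> (\<forall>k. [x (Suc k) = x k] (mod (int p ^ k)))"

definition Zp_cubic_split :: "nat \<Rightarrow> (nat \<Rightarrow> int) \<Rightarrow> (nat \<Rightarrow> int) \<Rightarrow> (nat \<Rightarrow> int) \<Rightarrow> bool" where
  "Zp_cubic_split p a b c \<longleftrightarrow> padic_seq p a \<and> padic_seq p b \<and> padic_seq p c \<and>
     (\<forall>k. [a k + b k + c k = 1] (mod (int p ^ k)) \<and>
          [a k * b k + b k * c k + c k * a k = -1] (mod (int p ^ k)) \<and>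
          [a k * b k * c k = 1] (mod (int p ^ k)))"

text \<open>N_p: order of the subgroup of (Z_p/pZ_p)^\<times> = (Z/pZ)^\<times> generated by the images of the roots.\<close>
definition Np :: "nat \<Rightarrow> (nat \<Rightarrow> int) \<Rightarrow> (nat \<Rightarrow> int) \<Rightarrow> (nat \<Rightarrow> int) \<Rightarrow> nat" where
  "Np p a b c = card (generate (units_of (residue_ring (int p)))
                   {a 1 mod int p, b 1 mod int p, c 1 mod int p})"

definition MLR :: "nat \<Rightarrow> bool" where
  "MLR p \<longleftrightarrow> (\<exists>Q::int. Q > 0 \<and> (\<forall>i\<in>{0..<Q}.
     (\<exists>\<kappa>::nat. finite {n::int. [n = i] (mod Q) \<and> vp p (of_int (T n)) \<noteq> ereal (of_nat \<kappa>)})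
   \<or> (\<exists>(a::rat) (\<kappa>::int) (\<mu>::int). \<mu> > 0 \<and> vp p (a - of_int i) \<ge> vp p (of_int Q) \<and>
        finite {n::int. [n = i] (mod Q) \<and>
           vp p (of_int (T n)) \<noteq> ereal (of_int \<kappa>) + ereal (of_int \<mu>) * vp p (of_int n - a)})))"

end

theory Submission
  imports Defs
begin

text \<open>Let N be the order in the statement and A, B, C the roots modulo a power of p. Since each
root satisfies X^N = 1 modulo p, expanding X^(Nm) gives
T(n + Nm) - T(n) = m (T(n + N) - T(n)) modulo p^(j+2) whenever p^j divides m. On a class l modulo N
with p dividing T(l), the hypothesis T(l + N) \<noteq> T(l) modulo p^2 thus makes T an isometry up to
the factor p, so it suffices to find a p-adic zero a of T in that class: then
\<nu>(T(n)) = 1 + \<nu>(n - a), and one may take Q = N. For a = 0, -1, -4, -17 this is an honest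
zero of T.

For a = 1/3 and a = -5/3, take 3m = 1 modulo N p^k. Then x = A^m, y = B^m, z = C^m are cube roots of
A, B, C with xyz = 1, and with e = x + y + z, f = xy + yz + zx the relations for A, B, C become
e^3 = 3ef - 2 and f^3 = 3ef - 4, whence (q - 2)(q^2 - 7q + 4) = 0 for q = ef. Up to a unit,
T(m) is the Schur polynomial f^2 - e and T(m - 2) is e^2 f - f^2 - e. If one of them vanishes
modulo p, then q = 2 modulo p; the second factor is then a unit, so q = 2 and e = f^2 modulo all
powers of p in question, and both Schur polynomials vanish to that precision.\<close>

subsection \<open>The recurrence over the integers\<close>

lemma trib_neg_Suc3: "trib_neg (k + 3) = trib_neg k - trib_neg (k + 1) - trib_neg (k + 2)"
  by (simp add: numeral_3_eq_3 numeral_2_eq_2)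

lemma trib_pos_Suc3: "trib_pos (k + 3) = trib_pos (k + 2) + trib_pos (k + 1) + trib_pos k"
  by (simp add: numeral_3_eq_3 numeral_2_eq_2)

lemma T_base: "T 0 = 0" "T 1 = 1" "T 2 = 1" "T (-1) = 0" "T (-2) = 1"
  by (simp_all add: T_def numeral_2_eq_2)

lemma T_rec: "T (n + 3) = T (n + 2) + T (n + 1) + T n"
proof -
  consider "n \<ge> 0" | "n = -1" | "n = -2" | "n \<le> -3" by linarith
  then show ?thesis
  proof cases
    case 1
    then obtain k where "n = int k" using nonneg_int_cases by blast
    moreover from this have "nat (n + 3) = k + 3" "nat (n + 2) = k + 2" "nat (n + 1) = k + 1"
      by simp_all
    ultimately show ?thesis using trib_pos_Suc3[of k] by (simp add: T_def)
  next
    case 4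
    define k where "k = nat (- n - 3)"
    have k: "nat (- (n + 3)) = k" "nat (- (n + 2)) = k + 1" "nat (- (n + 1)) = k + 2" "nat (- n) = k + 3"
      using 4 by (simp_all add: k_def)
    have neg: "T j = trib_neg (nat (- j))" if "j \<le> 0" for j
      using that by (auto simp: T_def)
    show ?thesis
    proof -
      have "T (n + 3) = trib_neg k" "T (n + 2) = trib_neg (k + 1)" "T (n + 1) = trib_neg (k + 2)"
        "T n = trib_neg (k + 3)"
        using 4 by (simp_all only: neg k)
      then show ?thesis using trib_neg_Suc3[of k] by linarith
    qed
  qed (simp_all add: T_base)
qed

text \<open>The recurrence can be solved for \<open>s n\<close> with coefficient 1, so divisibility
  also runs backwards. This carries facts read off from powers of the roots, available only for
  nonnegative indices, over to all integers.\<close>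

lemma recurrence_dvd:
  fixes s :: "int \<Rightarrow> int"
  assumes rec: "\<And>n. s (n + 3) = s (n + 2) + s (n + 1) + s n"
    and base: "M dvd s 0" "M dvd s 1" "M dvd s 2"
  shows "M dvd s n"
proof -
  have "M dvd s n \<and> M dvd s (n + 1) \<and> M dvd s (n + 2)"
  proof (induction n rule: int_induct[where k = 0])
    case base
    then show ?case using assms by simp
  next
    case (step1 i)
    then show ?case using rec[of i] by (simp add: add.assoc)
  next
    case (step2 i)
    have "s (i - 1) = s (i + 2) - s (i + 1) - s i"
      using rec[of "i - 1"] by (simp add: add.commute)
    then show ?case using step2 by (simp add: add.commute)
  qed
  then show ?thesis by simp
qed

subsection \<open>Powers of integers congruent to 1 modulo p\<close>

lemma cong_int_obtain:
  fixes x y m :: int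
  assumes "[x = y] (mod m)"
  obtains k where "x = y + m * k"
proof -
  from assms obtain k where "x - y = m * k"
    unfolding cong_iff_dvd_diff by (elim dvdE)
  then have "x = y + m * k" by simp
  then show ?thesis by (rule that)
qed

text \<open>Induction on j: for m = p m' and y = x^m', write y^p - 1 = (y - 1)(1 + y + ... +
  y^(p-1)), where the sum is p modulo p^2. Keeping the factor x - 1 exact, rather than bounding it,
  gains one more power of p when the formula is reduced.\<close>

lemma power_minus_one_expansion:
  fixes x :: int
  assumes "odd p" "[x = 1] (mod int p)" "p ^ j dvd m"
  shows "\<exists>s. x ^ m - 1 = (x - 1) * (int m + int p ^ (j + 1) * s)"
  using assms(3)
proof (induction j arbitrary: m)
  case 0
  have "[(\<Sum>i<m. x ^ i) = (\<Sum>i<m. 1 ^ i)] (mod int p)"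
    using assms(2) by (intro cong_sum cong_pow)
  then obtain s where "(\<Sum>i<m. x ^ i) = int m + int p * s"
    using cong_int_obtain[of "\<Sum>i<m. x ^ i" "int m" "int p"] by auto
  then show ?case using power_diff_1_eq[of x m] by auto
next
  case (Suc j)
  then obtain m' where m: "m = p * m'" and m': "p ^ j dvd m'"
    by (auto simp: dvd_def mult.assoc)
  obtain s where s: "x ^ m' - 1 = (x - 1) * (int m' + int p ^ (j + 1) * s)"
    using Suc.IH[OF m'] by blast
  define y where "y = x ^ m'"
  obtain u where u: "y = 1 + int p * u"
  proof -
    have "[y = 1 ^ m'] (mod int p)" unfolding y_def using assms(2) by (rule cong_pow)
    then show ?thesis using that by (auto elim: cong_int_obtain)
  qed
  have sq: "\<exists>v. (1 + int p * u) ^ i = 1 + int i * int p * u + (int p)\<^sup>2 * v" for i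
  proof (induction i)
    case (Suc i)
    then obtain v where v: "(1 + int p * u) ^ i = 1 + int i * int p * u + (int p)\<^sup>2 * v" by blast
    show ?case
      by (rule exI[of _ "v + int i * u\<^sup>2 + int p * u * v"])
         (simp only: v power_Suc, simp add: algebra_simps power2_eq_square)
  qed simp
  then obtain v where v: "\<And>i. y ^ i = 1 + int i * int p * u + (int p)\<^sup>2 * v i"
    unfolding u by metis
  \<comment> \<open>Oddness of p enters here: p divides 0 + 1 + ... + (p-1), so the linear terms of
    the y^i add up to a multiple of p^2.\<close>
  have tri: "(\<Sum>i<p. int i) = int p * ((int p - 1) div 2)"
  proof -
    have "2 * (\<Sum>i<k. int i) = int k * (int k - 1)" for k
      by (induction k) (auto simp: algebra_simps)
    from this[of p] have "2 * (\<Sum>i<p. int i) = int p * (2 * ((int p - 1) div 2))"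
      using assms(1) by (simp add: even_two_times_div_two)
    then show ?thesis by simp
  qed
  have "(\<Sum>i<p. y ^ i) = int p + (\<Sum>i<p. int i) * int p * u + (int p)\<^sup>2 * (\<Sum>i<p. v i)"
    by (simp add: v sum.distrib sum_distrib_left sum_distrib_right)
  then obtain w where w: "(\<Sum>i<p. y ^ i) = int p + (int p)\<^sup>2 * w"
    using that[of "((int p - 1) div 2) * u + (\<Sum>i<p. v i)"]
    by (simp add: tri algebra_simps power2_eq_square)
  obtain t where t: "int m' = int p ^ j * t"
  proof -
    obtain t where "m' = p ^ j * t" using m' by (elim dvdE)
    then show ?thesis using that[of "int t"] by simp
  qed
  have "x ^ m = y ^ p" unfolding m y_def by (simp add: power_mult[symmetric] mult.commute)
  then have "x ^ m - 1 = (y - 1) * (int p + (int p)\<^sup>2 * w)"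
    using power_diff_1_eq[of y p] w by simp
  also have "\<dots> = (x - 1) * ((int m' + int p ^ (j + 1) * s) * (int p + (int p)\<^sup>2 * w))"
    using s y_def by simp
  also have "(int m' + int p ^ (j + 1) * s) * (int p + (int p)\<^sup>2 * w) =
      int m + int p ^ (Suc j + 1) * (t * w + s + int p * s * w)"
  proof -
    have "int m' * ((int p)\<^sup>2 * w) = int p ^ (Suc j + 1) * (t * w)"
      unfolding t by (simp add: power2_eq_square)
    then show ?thesis unfolding m by (simp add: algebra_simps power2_eq_square)
  qed
  finally show ?case by blast
qed

lemma cong_one_power_lift:
  fixes x :: int
  assumes "odd p" "[x = 1] (mod int p)" "p ^ j dvd m"
  shows "[x ^ m = 1] (mod int p ^ (j + 1))"
    and "[x ^ m - 1 = int m * (x - 1)] (mod int p ^ (j + 2))"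
proof -
  obtain s where s: "x ^ m - 1 = (x - 1) * (int m + int p ^ (j + 1) * s)"
    using power_minus_one_expansion[OF assms] by blast
  obtain u where u: "x = 1 + int p * u"
    using assms(2) by (rule cong_int_obtain)
  have "x ^ m - 1 - int m * (x - 1) = int p ^ (j + 2) * (u * s)"
    unfolding s by (simp add: u algebra_simps)
  then show *: "[x ^ m - 1 = int m * (x - 1)] (mod int p ^ (j + 2))"
    by (simp add: cong_iff_dvd_diff)
  have "int p ^ j dvd int m" using assms(3) by (metis of_nat_dvd_iff of_nat_power)
  then have "int p ^ j * int p dvd int m * (x - 1)"
    using u by (intro mult_dvd_mono) simp_all
  then have "int p ^ (j + 1) dvd int m * (x - 1)" by (simp add: mult.commute)
  moreover have "int p ^ (j + 1) dvd x ^ m - 1 - int m * (x - 1)"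
    using * by (metis cong_iff_dvd_diff le_imp_power_dvd dvd_trans add_le_cancel_left one_le_numeral)
  ultimately have "int p ^ (j + 1) dvd x ^ m - 1"
    by (metis dvd_add diff_add_cancel)
  then show "[x ^ m = 1] (mod int p ^ (j + 1))" by (simp add: cong_iff_dvd_diff)
qed

subsection \<open>Binet formula modulo a prime power\<close>

text \<open>Vieta's relations at one finite precision. With M a power of p, they replace p-adic
  roots by integers, so all later identities are polynomial identities over the integers.\<close>

definition split_mod :: "int \<Rightarrow> int \<Rightarrow> int \<Rightarrow> int \<Rightarrow> bool" where
  "split_mod M A B C \<longleftrightarrow> [A + B + C = 1] (mod M) \<and>
     [A * B + B * C + C * A = -1] (mod M) \<and> [A * B * C = 1] (mod M)"

lemma split_mod_root:
  assumes "split_mod M A B C"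
  shows "[A ^ 3 = A\<^sup>2 + A + 1] (mod M)"
proof -
  have "A ^ 3 = (A + B + C) * A\<^sup>2 - (A * B + B * C + C * A) * A + A * B * C"
    by (simp add: algebra_simps power2_eq_square power3_eq_cube)
  also have "[\<dots> = 1 * A\<^sup>2 - (-1) * A + 1] (mod M)"
    using assms unfolding split_mod_def by (intro cong_add cong_diff cong_mult cong_refl) auto
  finally show ?thesis by simp
qed

lemma split_mod_rotate:
  "split_mod M A B C \<Longrightarrow> split_mod M B C A"
  by (simp add: split_mod_def algebra_simps)

definition vandermonde3 :: "int \<Rightarrow> int \<Rightarrow> int \<Rightarrow> int" where
  "vandermonde3 x y z = (x - y) * (x - z) * (y - z)"

text \<open>The general discriminant of a monic cubic, evaluated at elementary symmetric functions
  1, -1, 1. Since 44 = 2 * 2 * 11, only modulo 2 and 11 can two roots coincide.\<close>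

lemma split_mod_discriminant:
  assumes "split_mod M A B C"
  shows "[(vandermonde3 A B C)\<^sup>2 = -44] (mod M)"
proof -
  let ?e = "A + B + C" and ?f = "A * B + B * C + C * A" and ?g = "A * B * C"
  have "(vandermonde3 A B C)\<^sup>2 =
      ?e\<^sup>2 * ?f\<^sup>2 - 4 * ?f ^ 3 - 4 * (?e ^ 3 * ?g) + 18 * (?e * ?f * ?g) - 27 * ?g\<^sup>2"
    unfolding vandermonde3_def by (simp add: algebra_simps power2_eq_square power3_eq_cube)
  also have "[\<dots> = 1\<^sup>2 * (-1)\<^sup>2 - 4 * (-1) ^ 3 - 4 * (1 ^ 3 * 1) + 18 * (1 * (-1) * 1) - 27 * 1\<^sup>2] (mod M)"
    using assms unfolding split_mod_def
    by (intro cong_add cong_diff cong_mult cong_pow cong_refl) auto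
  finally show ?thesis by simp
qed

text \<open>Binet's formula with its denominators cleared by the Vandermonde product. Both sides
  obey the same recurrence modulo M, and the initial values are checked directly.\<close>

lemma split_mod_binet:
  assumes "split_mod M A B C"
  shows "[vandermonde3 A B C * T (int n) =
    A ^ (n + 1) * (B - C) - B ^ (n + 1) * (A - C) + C ^ (n + 1) * (A - B)] (mod M)"
proof (induction n rule: less_induct)
  case (less n)
  define F where "F = (\<lambda>n. A ^ (n + 1) * (B - C) - B ^ (n + 1) * (A - C) + C ^ (n + 1) * (A - B))"
  consider "n = 0" | "n = 1" | "n = 2" | "n \<ge> 3" by linarith
  then show ?case
  proof cases
    case 1
    then show ?thesis by (simp add: T_base algebra_simps)
  next
    case 2
    have "vandermonde3 A B C * T (int n) = F n"
      using 2 by (simp add: T_base F_def vandermonde3_def algebra_simps power2_eq_square)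
    then show ?thesis by (simp add: F_def)
  next
    case 3
    have "[vandermonde3 A B C * 1 = vandermonde3 A B C * (A + B + C)] (mod M)"
      using assms unfolding split_mod_def by (intro cong_mult cong_refl) (auto simp: cong_sym)
    also have "vandermonde3 A B C * (A + B + C) = F 2"
      unfolding F_def vandermonde3_def by (simp add: eval_nat_numeral algebra_simps)
    finally have "[vandermonde3 A B C * T (int n) = F n] (mod M)" using 3 by (simp add: T_base)
    then show ?thesis by (simp only: F_def)
  next
    case ge3: 4
    define k where "k = n - 3"
    have 4: "n = k + 3" using ge3 by (simp add: k_def)
    have IH: "[vandermonde3 A B C * T (int m) = F m] (mod M)" if "m < n" for m
      using less that by (simp add: F_def)
    note r = split_mod_root[OF assms] split_mod_root[OF split_mod_rotate[OF assms]]
      split_mod_root[OF split_mod_rotate[OF split_mod_rotate[OF assms]]]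
    have "vandermonde3 A B C * T (int n) = vandermonde3 A B C * T (int (k + 2))
        + vandermonde3 A B C * T (int (k + 1)) + vandermonde3 A B C * T (int k)"
      using T_rec[of "int k"] 4 by (simp add: algebra_simps)
    also have "[\<dots> = F (k + 2) + F (k + 1) + F k] (mod M)"
      using 4 by (intro cong_add IH) auto
    also have "F (k + 2) + F (k + 1) + F k = A ^ (k + 1) * (A\<^sup>2 + A + 1) * (B - C)
        - B ^ (k + 1) * (B\<^sup>2 + B + 1) * (A - C) + C ^ (k + 1) * (C\<^sup>2 + C + 1) * (A - B)"
      unfolding F_def by (simp add: algebra_simps power2_eq_square)
    also have "[\<dots> = A ^ (k + 1) * A ^ 3 * (B - C)
        - B ^ (k + 1) * B ^ 3 * (A - C) + C ^ (k + 1) * C ^ 3 * (A - B)] (mod M)"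
      by (intro cong_add cong_diff cong_mult cong_refl r[THEN cong_sym])
    also have "A ^ (k + 1) * A ^ 3 * (B - C)
        - B ^ (k + 1) * B ^ 3 * (A - C) + C ^ (k + 1) * C ^ 3 * (A - B) = F n"
      using 4 by (simp add: F_def eval_nat_numeral algebra_simps)
    finally show ?thesis by (simp add: F_def)
  qed
qed

lemma not_dvd_vandermonde3:
  assumes "prime p" "p \<notin> {2, 11}" "split_mod M A B C" "int p dvd M"
  shows "\<not> int p dvd vandermonde3 A B C"
proof
  assume "int p dvd vandermonde3 A B C"
  then have "int p dvd (vandermonde3 A B C)\<^sup>2" by (simp add: power2_eq_square)
  moreover have "[(vandermonde3 A B C)\<^sup>2 = -44] (mod int p)"
    using split_mod_discriminant[OF assms(3)] assms(4) by (rule cong_dvd_modulus)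
  ultimately have "int p dvd -44" using cong_dvd_iff by blast
  then have "int p dvd int (2 * 2 * 11)" by simp
  then have "p dvd 2 * 2 * 11" using of_nat_dvd_iff by blast
  moreover have "prime (2::nat)" "prime (11::nat)" by simp_all
  ultimately show False
    using assms(1,2) by (metis insertCI prime_dvd_mult_iff primes_dvd_imp_eq)
qed

text \<open>By Binet, a linear relation between powers that holds for all three roots passes to the
  corresponding shifts of T, once the Vandermonde product is cancelled as a unit modulo p.\<close>

lemma T_relation:
  assumes p: "prime p" "p \<notin> {2, 11}" and split: "split_mod (int p ^ k) A B C" "k > 0"
    and rel: "\<And>X. X \<in> {A, B, C} \<Longrightarrow> [u + v * X ^ g + w * X ^ h = 0] (mod int p ^ k)"
  shows "[u * T n + v * T (n + int g) + w * T (n + int h) = 0] (mod int p ^ k)"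
proof -
  let ?M = "int p ^ k"
  let ?V = "vandermonde3 A B C"
  define d where "d = (\<lambda>n. u * T n + v * T (n + int g) + w * T (n + int h))"
  have nonneg: "?M dvd d (int n)" for n
  proof -
    let ?F = "\<lambda>n. A ^ (n + 1) * (B - C) - B ^ (n + 1) * (A - C) + C ^ (n + 1) * (A - B)"
    have "?V * d (int n) =
        u * (?V * T (int n)) + v * (?V * T (int (n + g))) + w * (?V * T (int (n + h)))"
      unfolding d_def by (simp add: algebra_simps)
    also have "[\<dots> = u * ?F n + v * ?F (n + g) + w * ?F (n + h)] (mod ?M)"
      by (intro cong_add cong_mult cong_refl split_mod_binet split)
    also have "u * ?F n + v * ?F (n + g) + w * ?F (n + h) =
        A ^ (n + 1) * (B - C) * (u + v * A ^ g + w * A ^ h)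
      - B ^ (n + 1) * (A - C) * (u + v * B ^ g + w * B ^ h)
      + C ^ (n + 1) * (A - B) * (u + v * C ^ g + w * C ^ h)"
      by (simp add: power_add algebra_simps)
    also have "[\<dots> = A ^ (n + 1) * (B - C) * 0 - B ^ (n + 1) * (A - C) * 0
      + C ^ (n + 1) * (A - B) * 0] (mod ?M)"
      by (intro cong_add[OF cong_diff] cong_mult[OF cong_refl] rel) simp_all
    finally have "?M dvd ?V * d (int n)" by (simp add: cong_0_iff)
    moreover have "coprime ?M ?V"
    proof -
      have "coprime (int p) ?V"
        using not_dvd_vandermonde3[OF p split(1)] split(2) p(1)
        by (intro prime_imp_coprime) simp_all
      then show ?thesis by simp
    qed
    ultimately show ?thesis using coprime_dvd_mult_right_iff by blast
  qed
  have "?M dvd d n"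
  proof (rule recurrence_dvd[of d])
    have rec: "T (k + 3 + h) = T (k + 2 + h) + T (k + 1 + h) + T (k + h)" for k h
      using T_rec[of "k + h"] by (simp add: algebra_simps)
    show "d (k + 3) = d (k + 2) + d (k + 1) + d k" for k
      unfolding d_def T_rec[of k] rec[of k] by (simp add: distrib_left)
    show "?M dvd d 0" "?M dvd d 1" "?M dvd d 2"
      using nonneg[of 0] nonneg[of 1] nonneg[of 2] by simp_all
  qed
  then show ?thesis by (simp add: d_def cong_0_iff)
qed

subsection \<open>Cube roots of the roots\<close>

text \<open>Here q is the prime. The relations force x = e f to satisfy (x^2 - 7x + 4)(x - 2) = 0
  modulo q^k. At x = 2 the quadratic equals -6, a unit modulo q, so the linear factor absorbs the
  whole power q^k. Moreover f is a unit, since otherwise q would divide 2.\<close>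

lemma lift_dvd_of_elementary_symmetric:
  fixes q :: int
  assumes q: "prime q" "\<not> q dvd 6" and k: "k > 0"
    and h1: "q ^ k dvd e ^ 3 - 3 * e * f + 2" and h2: "q ^ k dvd f ^ 3 - 3 * e * f + 4"
    and ef: "q dvd e * f - 2"
  shows "q ^ k dvd e * f - 2" "q ^ k dvd e - f\<^sup>2"
proof -
  have n2: "\<not> q dvd 2" using q(2) dvd_trans[of q 2 6] by auto
  have cop: "q ^ k dvd v" if "q ^ k dvd u * v" "\<not> q dvd u" for u v
  proof -
    have "coprime (q ^ k) u" using that(2) q(1) by (simp add: prime_imp_coprime)
    then show ?thesis using that(1) coprime_dvd_mult_right_iff by blast
  qed
  have "6 = (e * f - 2) * (e * f - 5) - ((e * f)\<^sup>2 - 7 * (e * f) + 4)"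
    by (simp add: algebra_simps power2_eq_square)
  then have "\<not> q dvd (e * f)\<^sup>2 - 7 * (e * f) + 4"
    using q(2) ef by (metis dvd_diff dvd_mult2)
  \<comment> \<open>Multiplying e^3 = 3x - 2 by f^3 = 3x - 4 gives x^3 = (3x - 2)(3x - 4), whose
    difference factors as on the left.\<close>
  moreover have "((e * f)\<^sup>2 - 7 * (e * f) + 4) * (e * f - 2) =
      f ^ 3 * (e ^ 3 - 3 * e * f + 2) + (3 * e * f - 2) * (f ^ 3 - 3 * e * f + 4)"
    by (simp add: algebra_simps power2_eq_square power3_eq_cube)
  then have "q ^ k dvd ((e * f)\<^sup>2 - 7 * (e * f) + 4) * (e * f - 2)"
    using h1 h2 by simp
  ultimately show ef': "q ^ k dvd e * f - 2" using cop by blast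
  have "f * (e - f\<^sup>2) = - (2 * (e * f - 2)) - (f ^ 3 - 3 * e * f + 4)"
    by (simp add: algebra_simps power2_eq_square power3_eq_cube)
  then have "q ^ k dvd f * (e - f\<^sup>2)"
    using ef' h2 by (simp only: dvd_diff dvd_minus_iff dvd_mult)
  moreover have "\<not> q dvd f"
  proof
    assume f: "q dvd f"
    have "q dvd f ^ 3 - 3 * e * f + 4"
      using h2 k by (meson dvd_power dvd_trans)
    moreover have "q dvd f ^ 3" using f by (simp add: power3_eq_cube)
    moreover have "2 = f ^ 3 - (f ^ 3 - 3 * e * f + 4) - 3 * (e * f - 2)"
      by (simp add: algebra_simps)
    moreover have "q dvd 3 * (e * f - 2)" using ef by (rule dvd_mult)
    ultimately show False using n2 by (metis dvd_diff)
  qed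
  ultimately show "q ^ k dvd e - f\<^sup>2" using cop by blast
qed

lemma vandermonde3_cong:
  assumes "[x = x'] (mod M)" "[y = y'] (mod M)" "[z = z'] (mod M)"
  shows "[vandermonde3 x y z = vandermonde3 x' y' z'] (mod M)"
  unfolding vandermonde3_def using assms by (intro cong_mult cong_diff)

text \<open>If two cube roots agreed modulo p, so would two of the roots A, B, C. Hence the
  Vandermonde product of the cube roots is a unit as well.\<close>

lemma vandermonde3_cubes:
  "vandermonde3 x y z dvd vandermonde3 (x ^ 3) (y ^ 3) (z ^ 3)"
proof -
  have "s ^ 3 - t ^ 3 = (s - t) * (s\<^sup>2 + s * t + t\<^sup>2)" for s t :: int
    by (simp add: algebra_simps power2_eq_square power3_eq_cube)
  then show ?thesis unfolding vandermonde3_def by (simp add: mult_dvd_mono)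
qed

text \<open>The left side is the alternant with exponents 4, 3, 0. It is the Binet numerator of T(m)
  after A, B, C are replaced by cubes and A^m, B^m, C^m by x, y, z.\<close>

lemma schur_22:
  fixes x y z :: int
  shows "x ^ 3 * x * (y ^ 3 - z ^ 3) - y ^ 3 * y * (x ^ 3 - z ^ 3) + z ^ 3 * z * (x ^ 3 - y ^ 3) =
    vandermonde3 x y z * ((x * y + y * z + z * x)\<^sup>2 - (x + y + z) * (x * y * z))"
  unfolding vandermonde3_def by (simp add: algebra_simps power2_eq_square power3_eq_cube)

text \<open>The alternant with exponents 6, 3, 1, which arises in the same way from T(m - 2). Its
  quotient by the Vandermonde product is x y z times the Schur polynomial of the partition
  (3,1).\<close>

lemma schur_31:
  fixes x y z :: int
  shows "x * (y ^ 3 * z ^ 3) * (y ^ 3 - z ^ 3) - y * (x ^ 3 * z ^ 3) * (x ^ 3 - z ^ 3)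
      + z * (x ^ 3 * y ^ 3) * (x ^ 3 - y ^ 3) =
    vandermonde3 x y z * (x * y * z) * ((x + y + z)\<^sup>2 * (x * y + y * z + z * x)
      - (x * y + y * z + z * x)\<^sup>2 - (x + y + z) * (x * y * z))"
  unfolding vandermonde3_def by (simp add: algebra_simps power2_eq_square power3_eq_cube)

lemma T_third_lift:
  assumes p: "prime p" "p \<notin> {2, 11}" "p \<noteq> 3" and k: "k > 0"
    and split: "split_mod (int p ^ k) A B C"
    and root: "[A ^ (3 * m) = A] (mod int p ^ k)" "[B ^ (3 * m) = B] (mod int p ^ k)"
      "[C ^ (3 * m) = C] (mod int p ^ k)"
  shows "int p dvd T (int m) \<Longrightarrow> int p ^ k dvd T (int m)"
    and "int p dvd T (int m - 2) \<Longrightarrow> m \<ge> 2 \<Longrightarrow> int p ^ k dvd T (int m - 2)"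
proof -
  let ?M = "int p ^ k"
  let ?V = "vandermonde3 A B C"
  define x y z where xyz: "x = A ^ m" "y = B ^ m" "z = C ^ m"
  define e f g where efg: "e = x + y + z" "f = x * y + y * z + z * x" "g = x * y * z"
  let ?W = "vandermonde3 x y z"
  have pp: "prime (int p)" using p(1) by simp
  have pM: "int p dvd ?M" using k by simp
  have "\<not> p dvd 2" "\<not> p dvd 3"
    using p primes_dvd_imp_eq[of p 2] primes_dvd_imp_eq[of p 3] by auto
  then have "\<not> p dvd 2 * 3" using p(1) prime_dvd_mult_iff by blast
  then have "\<not> int p dvd int 6" by (subst of_nat_dvd_iff) simp
  then have n6: "\<not> int p dvd 6" by simp
  have "\<not> int p dvd int 2" using \<open>\<not> p dvd 2\<close> of_nat_dvd_iff by blast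
  then have n2: "\<not> int p dvd 2" by simp
  have cubes: "[x ^ 3 = A] (mod ?M)" "[y ^ 3 = B] (mod ?M)" "[z ^ 3 = C] (mod ?M)"
    using root by (simp_all add: xyz power_mult[symmetric] mult.commute)
  have g1: "[g = 1] (mod ?M)"
  proof -
    have "[(A * B * C) ^ m = 1 ^ m] (mod ?M)"
      using split unfolding split_mod_def by (intro cong_pow) auto
    then show ?thesis by (simp add: efg xyz power_mult_distrib)
  qed
  \<comment> \<open>Newton's identity turns e^3 - 3 e f + 3 g into the sum of the cubes, which is A
    + B + C = 1. The next relation is the same identity for the products x y, y z, z x, whose cubes
    add up to -1.\<close>
  have h1: "?M dvd e ^ 3 - 3 * e * f + 2"
  proof -
    have "e ^ 3 - 3 * e * f + 2 = x ^ 3 + y ^ 3 + z ^ 3 - 3 * g + 2"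
      unfolding efg by (simp add: algebra_simps power2_eq_square power3_eq_cube)
    also have "[\<dots> = A + B + C - 3 * 1 + 2] (mod ?M)"
      by (intro cong_add cong_diff cong_mult cong_refl cubes g1)
    also have "[A + B + C - 3 * 1 + 2 = 1 - 3 * 1 + 2] (mod ?M)"
      using split unfolding split_mod_def by (intro cong_add[of _ _ _ 2] cong_diff cong_refl) auto
    finally show ?thesis by (simp add: cong_0_iff)
  qed
  have h2: "?M dvd f ^ 3 - 3 * e * f + 4"
  proof -
    have "f ^ 3 - 3 * e * f + 4 =
        x ^ 3 * y ^ 3 + y ^ 3 * z ^ 3 + z ^ 3 * x ^ 3 + 3 * e * f * g - 3 * e * f - 3 * g\<^sup>2 + 4"
      unfolding efg by (simp add: algebra_simps power2_eq_square power3_eq_cube)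
    also have "[\<dots> = A * B + B * C + C * A + 3 * e * f * 1 - 3 * e * f - 3 * 1\<^sup>2 + 4] (mod ?M)"
      by (intro cong_add cong_diff cong_mult cong_pow cong_refl cubes g1)
    also have "A * B + B * C + C * A + 3 * e * f * 1 - 3 * e * f - 3 * 1\<^sup>2 + 4 =
        A * B + B * C + C * A + 1" by simp
    also have "[\<dots> = -1 + 1] (mod ?M)"
      using split unfolding split_mod_def by (intro cong_add[of _ _ _ 1] cong_refl) auto
    finally show ?thesis by (simp add: cong_0_iff)
  qed
  have h2p: "int p dvd f ^ 3 - 3 * e * f + 4" using h2 pM dvd_trans by blast
  have nV: "\<not> int p dvd ?V" using not_dvd_vandermonde3[OF p(1,2) split pM] .
  have "[vandermonde3 (x ^ 3) (y ^ 3) (z ^ 3) = ?V] (mod int p)"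
    using vandermonde3_cong[OF cubes] pM by (rule cong_dvd_modulus)
  then have nW: "\<not> int p dvd ?W"
    using nV vandermonde3_cubes cong_dvd_iff dvd_trans by blast
  \<comment> \<open>Shared by both claims, with s the Schur polynomial. The Vandermonde products on
    both sides are units, so T n and s are divisible by the same powers of p up to p^k. Vanishing of
    s modulo p gives e f = 2 modulo p, which lifts to p^k and makes s vanish there.\<close>
  have transfer: "?M dvd T n"
    if id: "[?V * T n = ?W * s] (mod ?M)" and n: "int p dvd T n"
      and s: "int p dvd s \<Longrightarrow> int p dvd e * f - 2"
      and s0: "\<And>u. u dvd e * f - 2 \<Longrightarrow> u dvd e - f\<^sup>2 \<Longrightarrow> u dvd s" for n s
  proof -
    have "[?V * T n = ?W * s] (mod int p)" using id pM by (rule cong_dvd_modulus)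
    then have "int p dvd ?W * s" using n cong_dvd_iff dvd_mult by blast
    then have "int p dvd s" using nW pp prime_dvd_mult_iff by blast
    then have "?M dvd s"
      using lift_dvd_of_elementary_symmetric[OF pp n6 k h1 h2 s] s0 by blast
    then have "?M dvd ?V * T n" using id cong_dvd_iff dvd_mult by blast
    moreover have "coprime ?M ?V" using nV pp by (simp add: prime_imp_coprime)
    ultimately show ?thesis using coprime_dvd_mult_right_iff by blast
  qed
  show "?M dvd T (int m)" if "int p dvd T (int m)"
  proof (rule transfer[OF _ that])
    have "[?V * T (int m) = A ^ (m + 1) * (B - C) - B ^ (m + 1) * (A - C) + C ^ (m + 1) * (A - B)] (mod ?M)"
      by (rule split_mod_binet[OF split])
    also have "A ^ (m + 1) * (B - C) - B ^ (m + 1) * (A - C) + C ^ (m + 1) * (A - B) =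
        A * x * (B - C) - B * y * (A - C) + C * z * (A - B)"
      by (simp add: xyz)
    also have "[\<dots> = x ^ 3 * x * (y ^ 3 - z ^ 3) - y ^ 3 * y * (x ^ 3 - z ^ 3)
        + z ^ 3 * z * (x ^ 3 - y ^ 3)] (mod ?M)"
      by (intro cong_add cong_diff cong_mult cong_refl cubes[THEN cong_sym])
    also have "x ^ 3 * x * (y ^ 3 - z ^ 3) - y ^ 3 * y * (x ^ 3 - z ^ 3)
        + z ^ 3 * z * (x ^ 3 - y ^ 3) = ?W * (f\<^sup>2 - e * g)"
      unfolding schur_22 efg ..
    also have "[\<dots> = ?W * (f\<^sup>2 - e * 1)] (mod ?M)"
      by (intro cong_diff cong_mult cong_refl g1)
    finally show "[?V * T (int m) = ?W * (f\<^sup>2 - e)] (mod ?M)" by simp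
    show "int p dvd e * f - 2" if "int p dvd f\<^sup>2 - e"
    proof -
      have "2 * (e * f - 2) = f * (f\<^sup>2 - e) - (f ^ 3 - 3 * e * f + 4)"
        by (simp add: algebra_simps power2_eq_square power3_eq_cube)
      then have "int p dvd 2 * (e * f - 2)" using that h2p by (metis dvd_diff dvd_mult)
      then show ?thesis using n2 pp prime_dvd_mult_iff by blast
    qed
    show "u dvd f\<^sup>2 - e" if "u dvd e - f\<^sup>2" for u
      using that by (simp add: dvd_diff_commute)
  qed
  show "?M dvd T (int m - 2)" if "int p dvd T (int m - 2)" "m \<ge> 2"
  proof (rule transfer[OF _ that(1)])
    \<comment> \<open>The inverse of a root is the product of the other two, which expresses X^(m-1)
      through X^m. The bound m >= 2 keeps the index m - 2 natural.\<close>
    have inv: "[X ^ (m - 1) = X ^ m * (Y * Z)] (mod ?M)" if "[X * Y * Z = 1] (mod ?M)" for X Y Z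
    proof -
      have "[X ^ (m - 1) * 1 = X ^ (m - 1) * (X * Y * Z)] (mod ?M)"
        using that by (intro cong_mult cong_refl) (rule cong_sym)
      also have "X ^ (m - 1) * (X * Y * Z) = X ^ m * (Y * Z)"
        using \<open>m \<ge> 2\<close> by (cases m) (simp_all add: algebra_simps)
      finally show ?thesis by simp
    qed
    have abc: "[A * B * C = 1] (mod ?M)" "[B * A * C = 1] (mod ?M)" "[C * A * B = 1] (mod ?M)"
      using split by (simp_all add: split_mod_def mult_ac)
    have idx: "int (m - 2) = int m - 2" "m - 2 + 1 = m - 1" using \<open>m \<ge> 2\<close> by auto
    have "[?V * T (int m - 2) = A ^ (m - 1) * (B - C) - B ^ (m - 1) * (A - C) + C ^ (m - 1) * (A - B)] (mod ?M)"
      using split_mod_binet[OF split, of "m - 2"] unfolding idx .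
    also have "[A ^ (m - 1) * (B - C) - B ^ (m - 1) * (A - C) + C ^ (m - 1) * (A - B) =
        x * (B * C) * (B - C) - y * (A * C) * (A - C) + z * (A * B) * (A - B)] (mod ?M)"
      unfolding xyz by (intro cong_add cong_diff cong_mult[OF _ cong_refl] inv abc)
    also have "[x * (B * C) * (B - C) - y * (A * C) * (A - C) + z * (A * B) * (A - B) =
        x * (y ^ 3 * z ^ 3) * (y ^ 3 - z ^ 3) - y * (x ^ 3 * z ^ 3) * (x ^ 3 - z ^ 3)
        + z * (x ^ 3 * y ^ 3) * (x ^ 3 - y ^ 3)] (mod ?M)"
      by (intro cong_add cong_diff cong_mult cong_refl cubes[THEN cong_sym])
    also have "x * (y ^ 3 * z ^ 3) * (y ^ 3 - z ^ 3) - y * (x ^ 3 * z ^ 3) * (x ^ 3 - z ^ 3)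
        + z * (x ^ 3 * y ^ 3) * (x ^ 3 - y ^ 3) = ?W * g * (e\<^sup>2 * f - f\<^sup>2 - e * g)"
      unfolding schur_31 efg ..
    also have "[\<dots> = ?W * 1 * (e\<^sup>2 * f - f\<^sup>2 - e * 1)] (mod ?M)"
      by (intro cong_diff cong_mult cong_refl g1)
    finally show "[?V * T (int m - 2) = ?W * (e\<^sup>2 * f - f\<^sup>2 - e)] (mod ?M)" by simp
    show "int p dvd e * f - 2" if "int p dvd e\<^sup>2 * f - f\<^sup>2 - e"
    proof -
      \<comment> \<open>Only the square of e f - 2 is reached, which suffices because p is
        prime.\<close>
      have "(e * f - 2)\<^sup>2 = f * (e\<^sup>2 * f - f\<^sup>2 - e) + (f ^ 3 - 3 * e * f + 4)"
        by (simp add: algebra_simps power2_eq_square power3_eq_cube)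
      then have "int p dvd (e * f - 2)\<^sup>2" using that h2p by (metis dvd_add dvd_mult)
      then show ?thesis using pp prime_dvd_power by blast
    qed
    show "u dvd e\<^sup>2 * f - f\<^sup>2 - e" if "u dvd e * f - 2" "u dvd e - f\<^sup>2" for u
    proof -
      have "e\<^sup>2 * f - f\<^sup>2 - e = e * (e * f - 2) + (e - f\<^sup>2)"
        by (simp add: algebra_simps power2_eq_square)
      then show ?thesis using that by (metis dvd_add dvd_mult)
    qed
  qed
qed

subsection \<open>Roots, their order modulo p, and valuations\<close>

lemma padic_seq_cong:
  assumes "padic_seq p x" "k \<le> l"
  shows "[x l = x k] (mod int p ^ k)"
  using assms(2)
proof (induction l rule: dec_induct)
  case (step l)
  have "[x (Suc l) = x l] (mod int p ^ l)" using assms(1) by (simp add: padic_seq_def)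
  then have "[x (Suc l) = x l] (mod int p ^ k)"
    using step.hyps(1) by (meson cong_dvd_modulus le_imp_power_dvd)
  then show ?case using step.IH cong_trans by blast
qed simp

lemma Zp_cubic_split_mod:
  assumes "Zp_cubic_split p a b c"
  shows "split_mod (int p ^ k) (a k) (b k) (c k)"
  using assms unfolding Zp_cubic_split_def split_mod_def by blast

text \<open>The cubic takes the values -1, -2, 1 at 0, 1, 2, so it has no root modulo 3. Hence 3 is
  invertible modulo p.\<close>

lemma Zp_cubic_split_neq_3:
  assumes "Zp_cubic_split p a b c"
  shows "p \<noteq> 3"
proof
  assume "p = 3"
  then have "[a 1 ^ 3 = (a 1)\<^sup>2 + a 1 + 1] (mod 3)"
    using split_mod_root[OF Zp_cubic_split_mod[OF assms, of 1]] by simp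
  then have "3 dvd a 1 ^ 3 - ((a 1)\<^sup>2 + a 1 + 1)" by (simp add: cong_iff_dvd_diff)
  moreover have "\<exists>t. a 1 = 3 * t \<or> a 1 = 3 * t + 1 \<or> a 1 = 3 * t + 2" by presburger
  then obtain t where "a 1 = 3 * t \<or> a 1 = 3 * t + 1 \<or> a 1 = 3 * t + 2" by blast
  then have "\<exists>s. a 1 ^ 3 - ((a 1)\<^sup>2 + a 1 + 1) = 3 * s + 1 \<or> a 1 ^ 3 - ((a 1)\<^sup>2 + a 1 + 1) = 3 * s + 2"
  proof (elim disjE)
    assume "a 1 = 3 * t"
    then show ?thesis
      by (intro exI[of _ "9 * t ^ 3 - 3 * t\<^sup>2 - t - 1"]) (simp add: algebra_simps power2_eq_square power3_eq_cube)
  next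
    assume "a 1 = 3 * t + 1"
    then show ?thesis
      by (intro exI[of _ "9 * t ^ 3 + 6 * t\<^sup>2 - 1"]) (simp add: algebra_simps power2_eq_square power3_eq_cube)
  next
    assume "a 1 = 3 * t + 2"
    then show ?thesis
      by (intro exI[of _ "9 * t ^ 3 + 15 * t\<^sup>2 + 7 * t"]) (simp add: algebra_simps power2_eq_square power3_eq_cube)
  qed
  ultimately show False by presburger
qed

text \<open>Lagrange in the generated subgroup gives s^n = 1. The subgroup lies in a group of p - 1
  elements, so 0 < n < p, and therefore p does not divide n.\<close>

lemma card_generate_units_residue_ring:
  fixes S :: "int set"
  assumes p: "prime p" and S: "\<And>s. s \<in> S \<Longrightarrow> \<not> int p dvd s"
  defines "n \<equiv> card (generate (units_of (residue_ring (int p))) ((\<lambda>s. s mod int p) ` S))"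
  shows "n > 0" "n < p" "s \<in> S \<Longrightarrow> [s ^ n = 1] (mod int p)"
proof -
  define R where "R = residue_ring (int p)"
  interpret residues_prime p R
    by (rule residues_prime.intro[OF p]) (rule R_def[THEN eq_reflection])
  let ?G = "units_of R"
  let ?X = "(\<lambda>s. s mod int p) ` S"
  let ?H = "generate ?G ?X"
  interpret G: group ?G by (rule units_group)
  have mem: "s mod int p \<in> Units R" if "s \<in> S" for s
    using S[OF that] p_coprime_right_int[of s] prime_gt_1_nat[OF p]
    by (intro mod_in_res_units) auto
  have X: "?X \<subseteq> carrier ?G" using mem by (auto simp: units_of_carrier)
  have sub: "subgroup ?H ?G" by (rule G.generate_is_subgroup[OF X])
  have HU: "?H \<subseteq> Units R" using G.generate_incl[OF X] by (simp add: units_of_carrier)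
  have fin: "finite ?H" using HU finite_Units finite_subset by blast
  have n: "n = card ?H" by (simp add: n_def R_def)
  have "\<one>\<^bsub>?G\<^esub> \<in> ?H" by (rule subgroup.one_closed[OF sub])
  then show "n > 0" using fin n card_gt_0_iff by blast
  have "card ?H \<le> card (Units R)" using HU finite_Units card_mono by blast
  also have "card (Units R) = p - 1" by (simp add: res_prime_units_eq)
  finally show "n < p" using n prime_gt_0_nat[OF p] by linarith
  show "[s ^ n = 1] (mod int p)" if s: "s \<in> S"
  proof -
    have "s mod int p \<in> ?H" using s by (intro generate.incl) auto
    interpret H: group "?G\<lparr>carrier := ?H\<rparr>" by (rule G.subgroup_imp_group[OF sub])
    have "(s mod int p) [^]\<^bsub>?G\<lparr>carrier := ?H\<rparr>\<^esub> order (?G\<lparr>carrier := ?H\<rparr>) = \<one>\<^bsub>?G\<lparr>carrier := ?H\<rparr>\<^esub>"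
      using \<open>s mod int p \<in> ?H\<close> by (intro H.pow_order_eq_1) simp
    then have "(s mod int p) [^]\<^bsub>?G\<^esub> n = \<one>\<^bsub>?G\<^esub>"
      by (simp add: G.nat_pow_consistent[symmetric] order_def n)
    then have "(s mod int p) [^]\<^bsub>R\<^esub> n = \<one>\<^bsub>R\<^esub>"
      using mem[OF s] by (simp add: units_of_pow units_of_one)
    then show ?thesis using pow_cong one_cong by (simp add: cong_def)
  qed
qed

text \<open>\<open>vp\<close> is read off the reduced fraction. Cross-multiplication shows that any
  other fraction for the same number gives the same difference of multiplicities.\<close>

lemma vp_fraction:
  assumes "prime p" "s \<noteq> 0" "d \<noteq> 0"
  shows "vp p (of_int s / of_int d) =
    ereal (of_int (int (multiplicity (int p) s) - int (multiplicity (int p) d)))"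
proof -
  define x :: rat where "x = of_int s / of_int d"
  obtain u w where uw: "quotient_of x = (u, w)" by fastforce
  have "w > 0" using quotient_of_denom_pos[OF uw] .
  have x: "x = of_int u / of_int w" using quotient_of_div[OF uw] .
  have "x \<noteq> 0" using assms by (simp add: x_def)
  then have "u \<noteq> 0" using x by auto
  have "of_int (s * w) = (of_int (u * d) :: rat)"
    using x x_def \<open>w > 0\<close> assms(3) by (simp add: field_simps)
  then have "s * w = u * d" by (simp only: of_int_eq_iff)
  then have "multiplicity (int p) (s * w) = multiplicity (int p) (u * d)" by simp
  moreover have "prime_elem (int p)" using assms(1) by simp
  ultimately have "multiplicity (int p) s + multiplicity (int p) w =
      multiplicity (int p) u + multiplicity (int p) d"
    using assms \<open>u \<noteq> 0\<close> \<open>w > 0\<close> by (simp add: prime_elem_multiplicity_mult_distrib)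
  then have "int (multiplicity (int p) s) - int (multiplicity (int p) d) =
      int (multiplicity (int p) u) - int (multiplicity (int p) w)" by linarith
  then show ?thesis
    using \<open>x \<noteq> 0\<close> unfolding x_def[symmetric] vp_def uw by simp
qed

lemma vp_of_int:
  assumes "prime p" "s \<noteq> 0"
  shows "vp p (of_int s) = ereal (of_int (int (multiplicity (int p) s)))"
  using vp_fraction[OF assms, of 1] by simp

subsection \<open>Valuations on residue classes\<close>

text \<open>Records the arithmetic facts about \<open>Np\<close> on which the valuation argument
  rests, separating it from the group theory.\<close>

locale split_tribonacci =
  fixes p N :: nat and a b c :: "nat \<Rightarrow> int"
  assumes p: "prime p" "p \<notin> {2, 11}"
    and split: "Zp_cubic_split p a b c"
    and root_order: "\<And>k x. k > 0 \<Longrightarrow> x \<in> {a, b, c} \<Longrightarrow> [x k ^ N = 1] (mod int p)"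
    and N_pos: "N > 0" and p_N: "\<not> p dvd N"
begin

lemma odd_p: "odd p"
  using p prime_odd_nat prime_ge_2_nat[of p] by (cases "p = 2") auto

lemma prime_int_p: "prime (int p)"
  using p(1) by simp

lemma p_neq_3: "p \<noteq> 3"
  by (rule Zp_cubic_split_neq_3[OF split])

lemma not_p_dvd_3: "\<not> int p dvd 3"
proof -
  have "\<not> p dvd 3" using p(1) p_neq_3 primes_dvd_imp_eq[of p 3] by auto
  then have "\<not> int p dvd int 3" using of_nat_dvd_iff by blast
  then show ?thesis by simp
qed

lemma not_p_dvd_N: "\<not> int p dvd int N"
  using p_N by simp

lemma root_power_one:
  assumes "p ^ j dvd m" "k > 0" "x \<in> {a, b, c}"
  shows "[x k ^ (N * m) = 1] (mod int p ^ (j + 1))"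
  using cong_one_power_lift(1)[OF odd_p root_order[OF assms(2,3)] assms(1)]
  by (simp add: power_mult)

section \<open>Differences of T inside a class modulo N\<close>

lemma T_step:
  assumes "p ^ j dvd m"
  shows "[T (n + int N * int m) - T n = int m * (T (n + int N) - T n)] (mod int p ^ (j + 2))"
proof -
  \<comment> \<open>All three roots satisfy (m - 1) + X^(N m) - m X^N = 0 at this precision, so
    \<open>T_relation\<close> applies with shifts N m and N.\<close>
  have "[(int m - 1) * T n + 1 * T (n + int (N * m)) + (- int m) * T (n + int N) = 0] (mod int p ^ (j + 2))"
  proof (rule T_relation[OF p Zp_cubic_split_mod[OF split]])
    fix X assume "X \<in> {a (j + 2), b (j + 2), c (j + 2)}"
    then have "[X ^ N = 1] (mod int p)" using root_order[of "j + 2"] by auto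
    then have "[(X ^ N) ^ m - 1 = int m * (X ^ N - 1)] (mod int p ^ (j + 2))"
      by (rule cong_one_power_lift(2)[OF odd_p _ assms])
    then show "[int m - 1 + 1 * X ^ (N * m) + - int m * X ^ N = 0] (mod int p ^ (j + 2))"
      by (simp add: cong_iff_dvd_diff power_mult algebra_simps)
  qed simp
  then show ?thesis by (simp add: cong_iff_dvd_diff algebra_simps)
qed

lemma T_periodic_nat:
  "[T (n + int (N * p ^ j * t)) = T n] (mod int p ^ (j + 1))"
proof -
  \<comment> \<open>The term with coefficient 0 only pads the relation to the three-term shape of
    \<open>T_relation\<close>.\<close>
  have "[(- 1) * T n + 1 * T (n + int (N * p ^ j * t)) + 0 * T (n + int 0) = 0] (mod int p ^ (j + 1))"
  proof (rule T_relation[OF p Zp_cubic_split_mod[OF split]])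
    fix X assume "X \<in> {a (j + 1), b (j + 1), c (j + 1)}"
    then have "[X ^ (N * (p ^ j * t)) = 1] (mod int p ^ (j + 1))"
      using root_power_one[of j "p ^ j * t" "j + 1"] by auto
    then show "[- 1 + 1 * X ^ (N * p ^ j * t) + 0 * X ^ 0 = 0] (mod int p ^ (j + 1))"
      by (simp add: cong_iff_dvd_diff mult.assoc)
  qed simp
  then show ?thesis by (simp add: cong_iff_dvd_diff)
qed

lemma T_periodic:
  assumes "[n = n'] (mod int (N * p ^ j))"
  shows "[T n = T n'] (mod int p ^ (j + 1))"
proof -
  obtain t where t: "n = n' + int (N * p ^ j) * t" using assms by (rule cong_int_obtain)
  show ?thesis
  proof (cases "t \<ge> 0")
    case True
    then show ?thesis using T_periodic_nat[of n' j "nat t"] t by simp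
  next
    case False
    then have "n' = n + int (N * p ^ j * nat (- t))" using t by simp
    then show ?thesis using T_periodic_nat[of n j "nat (- t)"] by (metis cong_sym)
  qed
qed

text \<open>With j = 0, \<open>T_step\<close> says that T(n + N t) is affine in t modulo p^2, so its
  increments are constant. A nonzero increment at one representative is thus nonzero on the whole
  class.\<close>

lemma T_increment_nat:
  "[T (n + int N * int t + int N) - T (n + int N * int t) = T (n + int N) - T n] (mod int p ^ 2)"
proof -
  have "[T (n + int N * int (t + 1)) - T n - (T (n + int N * int t) - T n) =
      int (t + 1) * (T (n + int N) - T n) - int t * (T (n + int N) - T n)] (mod int p ^ (0 + 2))"
    by (intro cong_diff T_step) simp_all
  then show ?thesis by (simp add: algebra_simps power2_eq_square)
qed

lemma T_increment:
  assumes "[n = n'] (mod int N)"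
  shows "[T (n + int N) - T n = T (n' + int N) - T n'] (mod int p ^ 2)"
proof -
  obtain t where t: "n = n' + int N * t" using assms by (rule cong_int_obtain)
  show ?thesis
  proof (cases "t \<ge> 0")
    case True
    then show ?thesis using T_increment_nat[of n' "nat t"] t by simp
  next
    case False
    then have "n' = n + int N * int (nat (- t))" using t by simp
    then show ?thesis using T_increment_nat[of n "nat (- t)"] by (metis cong_sym)
  qed
qed

text \<open>The increment T(n + N) - T(n) is divisible by p exactly once and m exactly j times. The
  precision p^(j+2) of \<open>T_step\<close> is just enough to see the resulting exponent j +
  1.\<close>

lemma T_difference_nat:
  assumes l: "\<not> [T (n + int N) = T n] (mod int p ^ 2)"
    and m: "int p ^ j dvd int m" "\<not> int p ^ (j + 1) dvd int m"
  shows "int p ^ (j + 1) dvd T (n + int N * int m) - T n"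
    and "\<not> int p ^ (j + 2) dvd T (n + int N * int m) - T n"
proof -
  have "p ^ j dvd m" using m(1) by (metis of_nat_dvd_iff of_nat_power)
  then have step: "[T (n + int N * int m) - T n = int m * (T (n + int N) - T n)] (mod int p ^ (j + 2))"
    by (rule T_step)
  have "[T (n + int N) = T n] (mod int p ^ (0 + 1))" by (rule T_periodic) (simp add: cong_def)
  then obtain d where d: "T (n + int N) - T n = int p * d"
    by (auto simp: cong_iff_dvd_diff)
  have nd: "\<not> int p dvd d"
    using l d by (auto simp: cong_iff_dvd_diff power2_eq_square)
  obtain u where u: "int m = int p ^ j * u" using m(1) by (elim dvdE)
  have nu: "\<not> int p dvd u" using m(2) u by auto
  have p0: "int p \<noteq> 0" using p(1) by auto
  have prod: "int m * (T (n + int N) - T n) = int p ^ (j + 1) * (u * d)"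
    unfolding u d by simp
  have "[T (n + int N * int m) - T n = int p ^ (j + 1) * (u * d)] (mod int p ^ (j + 1))"
    using step unfolding prod by (rule cong_dvd_modulus) (simp add: le_imp_power_dvd)
  then show "int p ^ (j + 1) dvd T (n + int N * int m) - T n"
    by (simp add: cong_dvd_iff)
  have "\<not> int p dvd u * d" using nu nd prime_int_p prime_dvd_mult_iff by blast
  then have "\<not> int p ^ (j + 2) dvd int p ^ (j + 1) * (u * d)"
    using p0 by simp
  then show "\<not> int p ^ (j + 2) dvd T (n + int N * int m) - T n"
    using step unfolding prod by (simp add: cong_dvd_iff)
qed

text \<open>On the class of l, T multiplies p-adic distances by exactly 1/p. Writing n - n' = N t,
  the unit N does not affect the exponent, and for t < 0 the two points exchange roles.\<close>

lemma T_difference: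
  assumes l: "\<not> [T (l + int N) = T l] (mod int p ^ 2)"
    and n: "[n = l] (mod int N)" "[n' = l] (mod int N)"
    and j: "int p ^ j dvd n - n'" "\<not> int p ^ (j + 1) dvd n - n'"
  shows "int p ^ (j + 1) dvd T n - T n'" "\<not> int p ^ (j + 2) dvd T n - T n'"
proof -
  have l': "\<not> [T (k + int N) = T k] (mod int p ^ 2)" if "[k = l] (mod int N)" for k
    using l cong_dvd_iff[OF T_increment[OF that]] unfolding cong_iff_dvd_diff by blast
  have dvd_N: "int p ^ i dvd int N * s \<longleftrightarrow> int p ^ i dvd s" for i s
  proof -
    have "coprime (int p ^ i) (int N)"
      using not_p_dvd_N prime_int_p by (simp add: prime_imp_coprime)
    then show ?thesis by (rule coprime_dvd_mult_right_iff)
  qed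
  obtain t where t: "n = n' + int N * t"
    using cong_trans[OF n(1) cong_sym[OF n(2)]] by (rule cong_int_obtain)
  have tj: "int p ^ j dvd t" "\<not> int p ^ (j + 1) dvd t"
    using j unfolding t add_diff_cancel_left' dvd_N by simp_all
  have "int p ^ (j + 1) dvd T n - T n' \<and> \<not> int p ^ (j + 2) dvd T n - T n'"
  proof (cases "t \<ge> 0")
    case True
    then have "n = n' + int N * int (nat t)" "int (nat t) = t" using t by simp_all
    then show ?thesis
      using T_difference_nat[OF l'[OF n(2)], of j "nat t"] tj by simp
  next
    case False
    then have s: "n' = n + int N * int (nat (- t))" "int (nat (- t)) = - t" using t by simp_all
    then have "int p ^ (j + 1) dvd T n' - T n \<and> \<not> int p ^ (j + 2) dvd T n' - T n"
      using T_difference_nat[OF l'[OF n(1)], of j "nat (- t)"] tj by simp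
    then show ?thesis by (metis dvd_diff_commute)
  qed
  then show "int p ^ (j + 1) dvd T n - T n'" "\<not> int p ^ (j + 2) dvd T n - T n'" by auto
qed

section \<open>Approximate zeros and the resulting valuations\<close>

lemma coprime_3:
  assumes "\<not> 3 dvd N"
  shows "coprime 3 (int (N * p ^ k))"
proof -
  have "prime (3::nat)" by simp
  then have "coprime 3 N" using assms by (simp add: prime_imp_coprime)
  moreover have "coprime 3 p" using p(1) p_neq_3 primes_coprime[of 3 p] by simp
  ultimately have "coprime 3 (N * p ^ k)" by simp
  then show ?thesis by (metis coprime_int_iff of_nat_numeral)
qed

text \<open>The integer r is three times the rational zero a, which keeps all congruences integral.
  If 3 divides r, then r/3 is an exact zero of T. Otherwise n is m or m - 2 with 3m = 1 modulo N
  p^k, so that it approximates 1/3 or -5/3.\<close>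

lemma T_approximate_zero:
  assumes "\<not> 3 dvd N" and l: "int p dvd T l" "[3 * l = r] (mod int N)"
    and r: "r \<in> {0, -3, -12, -51, 1, -5}"
  obtains n where "[3 * n = r] (mod int (N * p ^ k))" "int p ^ (k + 1) dvd T n"
proof -
  note witness = that
  note cop3 = coprime_3[OF assms(1), of k]
  have integral: thesis if "r = 3 * s" "T s = 0" for s
    using that witness[of s] by simp
  have T0: "T 0 = 0" "T (-1) = 0" "T (-4) = 0" "T (-17) = 0"
    by (simp_all add: T_def eval_nat_numeral)
  have third: thesis if "r = 1 - 3 * s" "s = 0 \<or> s = 2" for s
  proof -
    let ?Q = "int (N * p ^ k)"
    have Q: "?Q \<ge> 1" using N_pos p(1) prime_gt_0_nat
      by (metis Suc_leI One_nat_def mult_pos_pos of_nat_1 of_nat_mono zero_less_power)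
    obtain m0 where m0: "[3 * m0 = 1] (mod ?Q)"
      using cong_solve_coprime_int[OF cop3] by blast
    \<comment> \<open>Adding twice the modulus ensures m >= 2, so that m - 2 is a natural
      index.\<close>
    define m where "m = nat (m0 mod ?Q + 2 * ?Q)"
    have "m0 mod ?Q \<ge> 0" using Q by simp
    then have im: "int m = m0 mod ?Q + 2 * ?Q" using Q by (simp add: m_def)
    have "int m \<ge> 2" unfolding im using \<open>m0 mod ?Q \<ge> 0\<close> Q by linarith
    then have m2: "m \<ge> 2" by simp
    have "[int m = m0] (mod ?Q)" unfolding im by (simp add: cong_def)
    then have m3: "[3 * int m = 1] (mod ?Q)"
      using m0 cong_trans cong_scalar_left by blast
    then obtain t where t: "3 * int m = 1 + ?Q * t" by (rule cong_int_obtain)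
    have "t \<ge> 0"
    proof (rule ccontr)
      assume "\<not> t \<ge> 0"
      then have "?Q * t \<le> 0" using Q by (intro mult_nonneg_nonpos) auto
      then show False using t m2 by linarith
    qed
    then have "int (3 * m) = int (1 + N * (p ^ k * nat t))" using t by simp
    then have tn: "3 * m = 1 + N * (p ^ k * nat t)" by (simp only: of_nat_eq_iff)
    have root: "[x (k + 1) ^ (3 * m) = x (k + 1)] (mod int p ^ (k + 1))" if "x \<in> {a, b, c}" for x
    proof -
      have "[x (k + 1) * x (k + 1) ^ (N * (p ^ k * nat t)) = x (k + 1) * 1] (mod int p ^ (k + 1))"
        using that by (intro cong_mult cong_refl root_power_one) simp_all
      then show ?thesis by (simp add: tn)
    qed
    have n3: "[3 * (int m - s) = r] (mod ?Q)"
      using m3 that(1) by (simp add: cong_iff_dvd_diff)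
    then have "[3 * (int m - s) = 3 * l] (mod int N)"
      using l(2) by (metis cong_dvd_modulus cong_sym cong_trans dvd_triv_left of_nat_mult)
    moreover have "coprime 3 (int N)" using cop3 by simp
    ultimately have "[int m - s = l] (mod int N)" using cong_mult_lcancel by blast
    \<comment> \<open>Only divisibility by p is inherited from l, through the common class modulo N.
      \<open>T_third_lift\<close> then raises it to p^(k+1).\<close>
    then have "[T (int m - s) = T l] (mod int p)" using T_periodic[of "int m - s" l 0] by simp
    then have "int p dvd T (int m - s)" using l(1) cong_dvd_iff by blast
    then have "int p ^ (k + 1) dvd T (int m - s)"
      using T_third_lift[OF p p_neq_3 _ Zp_cubic_split_mod[OF split, of "k + 1"]
          root[of a] root[of b] root[of c]] m2 that(2) by auto
    then show thesis using n3 witness by blast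
  qed
  from r show thesis
    using integral[of 0] integral[of "-1"] integral[of "-4"] integral[of "-17"] T0 third[of 0] third[of 2]
    by auto
qed

text \<open>Compare n with an approximate zero n' close enough to r/3. Then T(n) has the same
  exponent as T(n) - T(n'), which is one more than that of n - n', and this in turn equals that of
  3n - r because 3 is a unit.\<close>

lemma T_multiplicity:
  assumes "\<not> 3 dvd N" and l: "int p dvd T l" "[3 * l = r] (mod int N)"
      "\<not> [T (l + int N) = T l] (mod int p ^ 2)"
    and r: "r \<in> {0, -3, -12, -51, 1, -5}"
    and n: "[n = l] (mod int N)" "3 * n \<noteq> r"
  shows "T n \<noteq> 0" "multiplicity (int p) (T n) = multiplicity (int p) (3 * n - r) + 1"
proof -
  define j where "j = multiplicity (int p) (3 * n - r)"
  have nu: "\<not> is_unit (int p)" using prime_int_p not_prime_unit by blast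
  have j: "int p ^ j dvd 3 * n - r" "\<not> int p ^ (j + 1) dvd 3 * n - r"
    using n(2) nu power_dvd_iff_le_multiplicity[of "3 * n - r" "int p" "j + 1"]
    by (simp_all add: j_def multiplicity_dvd)
  \<comment> \<open>With j the exponent of 3n - r, this precision decides divisibility of n - n' up
    to p^(j+1), and T(n') vanishes modulo p^(j+2), one power beyond the expected exponent of
    T(n).\<close>
  obtain n' where n': "[3 * n' = r] (mod int (N * p ^ (j + 1)))" "int p ^ (j + 1 + 1) dvd T n'"
    using T_approximate_zero[OF assms(1) l(1,2) r] by blast
  have cN: "[3 * n' = r] (mod int N)" and cp: "[3 * n' = r] (mod int p ^ (j + 1))"
    using n'(1) by (auto intro: cong_dvd_modulus)
  have "coprime 3 (int N)" using coprime_3[OF assms(1), of 0] by simp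
  moreover have "[3 * n' = 3 * l] (mod int N)" using cN l(2) cong_sym cong_trans by blast
  ultimately have nl: "[n' = l] (mod int N)" by (simp add: cong_mult_lcancel)
  have dvd_3: "int p ^ i dvd 3 * s \<longleftrightarrow> int p ^ i dvd s" for i s
  proof -
    have "coprime (int p ^ i) 3"
      using not_p_dvd_3 prime_int_p by (simp add: prime_imp_coprime)
    then show ?thesis by (rule coprime_dvd_mult_right_iff)
  qed
  have "[3 * n - 3 * n' = 3 * n - r] (mod int p ^ (j + 1))"
    using cp by (intro cong_diff cong_refl)
  then have *: "[3 * (n - n') = 3 * n - r] (mod int p ^ (j + 1))"
    by (simp add: right_diff_distrib)
  have diff: "int p ^ i dvd n - n' \<longleftrightarrow> int p ^ i dvd 3 * n - r" if "i \<le> j + 1" for i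
  proof -
    have "[3 * (n - n') = 3 * n - r] (mod int p ^ i)"
      using cong_dvd_modulus[OF * le_imp_power_dvd[OF that]] .
    then show ?thesis using dvd_3 cong_dvd_iff by blast
  qed
  have "int p ^ (j + 1) dvd T n - T n'" "\<not> int p ^ (j + 2) dvd T n - T n'"
    using T_difference[OF l(3) n(1) nl, of j] j diff[of j] diff[of "j + 1"] by auto
  moreover have n'2: "int p ^ (j + 2) dvd T n'" using n'(2) by simp
  moreover have "int p ^ (j + 1) dvd T n'"
    by (rule dvd_trans[OF le_imp_power_dvd n'2]) simp
  ultimately have *: "int p ^ (j + 1) dvd T n" "\<not> int p ^ (j + 2) dvd T n"
    using dvd_add[of "int p ^ (j + 1)" "T n - T n'" "T n'"] dvd_diff[of "int p ^ (j + 2)" "T n" "T n'"]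
    by auto
  then show "T n \<noteq> 0" by auto
  show "multiplicity (int p) (T n) = multiplicity (int p) (3 * n - r) + 1"
    using * unfolding j_def[symmetric] by (intro multiplicity_eqI) simp_all
qed

end

section \<open>From the stated hypotheses to the conclusion\<close>

lemma rat_cong_imp_cong_triple:
  assumes "rat_cong (of_int l) x N" "of_int r = 3 * x"
  shows "[3 * l = r] (mod N)"
proof -
  obtain m u v where m: "coprime m N" "of_int u = of_int m * (of_int l :: rat)"
      "of_int v = of_int m * x" "[u = v] (mod N)"
    using assms(1) unfolding rat_cong_def by blast
  have "u = m * l" using m(2) by (metis of_int_eq_iff of_int_mult)
  moreover have "of_int (3 * v) = (of_int (m * r) :: rat)" using m(3) assms(2) by simp
  then have "3 * v = m * r" by (simp only: of_int_eq_iff)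
  moreover have "[3 * u = 3 * v] (mod N)" using m(4) by (rule cong_scalar_left)
  ultimately have "[m * (3 * l) = m * r] (mod N)" by (simp add: mult.left_commute)
  then show ?thesis using m(1) cong_mult_lcancel by blast
qed

lemma split_tribonacci_Np:
  assumes "prime p" "p \<notin> {2, 11}" "Zp_cubic_split p a b c"
  shows "split_tribonacci p (Np p a b c) a b c"
proof
  let ?N = "Np p a b c"
  \<comment> \<open>The product of the roots is 1, so each of them is a unit modulo p.\<close>
  have abc: "[a 1 * b 1 * c 1 = 1] (mod int p)"
    using Zp_cubic_split_mod[OF assms(3), of 1] by (simp add: split_mod_def)
  have "\<not> int p dvd 1" using assms(1) by auto
  then have "\<not> int p dvd a 1 * b 1 * c 1" using abc cong_dvd_iff by blast
  then have ndvd: "\<not> int p dvd s" if "s \<in> {a 1, b 1, c 1}" for s using that by auto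
  have N: "?N = card (generate (units_of (residue_ring (int p))) ((\<lambda>s. s mod int p) ` {a 1, b 1, c 1}))"
    by (simp add: Np_def)
  have facts: "?N > 0" "?N < p" "s \<in> {a 1, b 1, c 1} \<Longrightarrow> [s ^ ?N = 1] (mod int p)" for s
    unfolding N using card_generate_units_residue_ring[OF assms(1), of "{a 1, b 1, c 1}"] ndvd
    by blast+
  show "?N > 0" by (rule facts)
  then show "\<not> p dvd ?N" using facts(2) nat_dvd_not_less by blast
  show "[x k ^ ?N = 1] (mod int p)" if "k > 0" "x \<in> {a, b, c}" for k x
  proof -
    have "padic_seq p x" using that(2) assms(3) by (auto simp: Zp_cubic_split_def)
    then have "[x k = x 1] (mod int p ^ 1)" using that(1) by (intro padic_seq_cong) simp_all
    then have "[x k ^ ?N = x 1 ^ ?N] (mod int p)" by (intro cong_pow) simp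
    also have "[x 1 ^ ?N = 1] (mod int p)" using that(2) by (intro facts) auto
    finally show ?thesis .
  qed
qed (use assms in auto)

theorem theorem24:
  fixes p :: nat and a b c :: "nat \<Rightarrow> int"
  assumes "prime p" and "p \<notin> {2, 11}"
    and "Zp_cubic_split p a b c"
    and "\<not> 3 dvd Np p a b c"
    and "\<forall>l::int. 0 \<le> l \<and> l < int (Np p a b c) \<and> int p dvd T l \<longrightarrow>
           \<not> [T (l + int (Np p a b c)) = T l] (mod (int p ^ 2)) \<and>
           (\<exists>r\<in>{0, -1, -4, -17, 1/3, -5/3 :: rat}. rat_cong (of_int l) r (int (Np p a b c)))"
  shows "MLR p"
proof -
  define N where "N = Np p a b c"
  interpret split_tribonacci p N a b c
    unfolding N_def by (rule split_tribonacci_Np[OF assms(1-3)])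
  have nu: "\<not> is_unit (int p)" using prime_int_p not_prime_unit by blast
  show ?thesis unfolding MLR_def
  proof (intro exI[of _ "int N"] conjI ballI)
    show "int N > 0" using N_pos by simp
    fix i assume i: "i \<in> {0..<int N}"
    show "(\<exists>\<kappa>::nat. finite {n::int. [n = i] (mod int N) \<and> vp p (of_int (T n)) \<noteq> ereal (of_nat \<kappa>)})
      \<or> (\<exists>(a::rat) (\<kappa>::int) (\<mu>::int). \<mu> > 0 \<and> vp p (a - of_int i) \<ge> vp p (of_int (int N)) \<and>
        finite {n::int. [n = i] (mod int N) \<and>
           vp p (of_int (T n)) \<noteq> ereal (of_int \<kappa>) + ereal (of_int \<mu>) * vp p (of_int n - a)})"
    proof (cases "int p dvd T i")
      case False
      \<comment> \<open>Case (C) with constant 0: T is periodic modulo p with period N.\<close>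
      have "vp p (of_int (T n)) = ereal (of_nat 0)" if "[n = i] (mod int N)" for n
      proof -
        have "[T n = T i] (mod int p)" using T_periodic[of n i 0] that by simp
        then have "\<not> int p dvd T n" using False cong_dvd_iff by blast
        moreover from this have "T n \<noteq> 0" by auto
        ultimately show ?thesis
          using vp_of_int[OF p(1), of "T n"] by (simp add: not_dvd_imp_multiplicity_0)
      qed
      then have "{n::int. [n = i] (mod int N) \<and> vp p (of_int (T n)) \<noteq> ereal (of_nat 0)} = {}"
        by blast
      then show ?thesis by (metis finite.emptyI)
    next
      case True
      then have inc: "\<not> [T (i + int N) = T i] (mod int p ^ 2)"
        and "\<exists>x\<in>{0, -1, -4, -17, 1/3, -5/3 :: rat}. rat_cong (of_int i) x (int N)"
        using assms(5) i unfolding N_def by auto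
      then obtain x :: rat where x: "x \<in> {0, -1, -4, -17, 1/3, -5/3}" "rat_cong (of_int i) x (int N)"
        by blast
      obtain r :: int where r: "r \<in> {0, -3, -12, -51, 1, -5}" "of_int r = 3 * x"
      proof -
        have "\<exists>r\<in>{0, -3, -12, -51, 1, -5 :: int}. of_int r = 3 * x" using x(1) by auto
        then show ?thesis using that by blast
      qed
      have ir: "[3 * i = r] (mod int N)" by (rule rat_cong_imp_cong_triple[OF x(2) r(2)])
      have mult3: "multiplicity (int p) 3 = 0"
        using not_p_dvd_3 by (rule not_dvd_imp_multiplicity_0)
      have vp_third: "vp p (of_int s / 3) = ereal (of_int (int (multiplicity (int p) s)))"
        if "s \<noteq> 0" for s
        using vp_fraction[OF p(1) that, of 3] by (simp add: mult3)
      have "vp p (of_int n - x) = ereal (of_int (int (multiplicity (int p) (3 * n - r))))"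
        if "3 * n \<noteq> r" for n
      proof -
        have "of_int n - x = of_int (3 * n - r) / 3" using r(2) by simp
        then show ?thesis using vp_third[of "3 * n - r"] that by (simp only: right_minus_eq simp_thms)
      qed
      then have L: "vp p (of_int (T n)) = ereal (of_int 1) + ereal (of_int 1) * vp p (of_int n - x)"
        if "[n = i] (mod int N)" "3 * n \<noteq> r" for n
        using T_multiplicity[OF assms(4)[folded N_def] True ir inc r(1) that] that(2)
          vp_of_int[OF p(1), of "T n"] by simp
      \<comment> \<open>The formula has been shown for every n in the class with 3n distinct from r,
        so at most the single index r/3 remains.\<close>
      have "{n::int. [n = i] (mod int N) \<and>
          vp p (of_int (T n)) \<noteq> ereal (of_int 1) + ereal (of_int 1) * vp p (of_int n - x)} \<subseteq> {r div 3}"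
      proof
        fix n assume "n \<in> {n::int. [n = i] (mod int N) \<and>
          vp p (of_int (T n)) \<noteq> ereal (of_int 1) + ereal (of_int 1) * vp p (of_int n - x)}"
        then have "3 * n = r" using L by blast
        then show "n \<in> {r div 3}" by auto
      qed
      then have fin: "finite {n::int. [n = i] (mod int N) \<and>
          vp p (of_int (T n)) \<noteq> ereal (of_int 1) + ereal (of_int 1) * vp p (of_int n - x)}"
        by (rule finite_subset) simp
      \<comment> \<open>The left side is 0 since p does not divide N, and x - i has a denominator
        dividing 3, hence prime to p. If x = i, the right side is infinite.\<close>
      have "vp p (of_int (int N)) \<le> vp p (x - of_int i)"
      proof -
        have "vp p (of_int (int N)) = 0"
          using vp_of_int[OF p(1), of "int N"] N_pos not_p_dvd_N
          by (simp add: not_dvd_imp_multiplicity_0)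
        moreover have eq: "x - of_int i = of_int (r - 3 * i) / 3" using r(2) by simp
        have "vp p (x - of_int i) \<ge> 0"
        proof (cases "r - 3 * i = 0")
          case True
          then show ?thesis unfolding eq by (simp only:) (simp add: vp_def)
        next
          case False
          then show ?thesis unfolding eq vp_third[OF False] by simp
        qed
        ultimately show ?thesis by simp
      qed
      then show ?thesis using fin by (intro disjI2 exI[of _ x] exI[of _ 1] conjI) simp_all
    qed
  qed
qed

end
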